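(* Let $q$ and $t$ be positive integers and let $H$ be a $q$-uniform, $M_{\aleph_0}^{(q)}(t)$-free hypergraph. If $H$ contains arbitrarily large finite independent sets, then $H$ contains an infinite independent set.
   Context: A $q$-uniform hypergraph consists of a (possibly infinite) vertex set and a collection of $q$-element subsets of it, called edges. A set of vertices is independent if it contains no edge. $M_{\aleph_0}^{(q)}(t)$ denotes the class of all $q$-uniform hypergraphs whose vertex set is the disjoint union of countably infinitely many parts, each of size $t$, such that every $q$-element set of vertices meeting each part in at most one vertex is an edge, and no edge is contained in a single part. There is no restriction on the remaining $q$-element sets (those meeting more than one but fewer than $q$ parts): each may or may not be an edge. A $q$-uniform hypergraph $H$ is $M_{\aleph_0}^{(q)}(t)$-free if no induced subhypergraph of $H$ is isomorphic to a member of this class. *)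

theory Defs
  imports Main "HOL-Library.Disjoint_Sets"
begin

record 'a hypergraph =
  vertices :: "'a set"
  edges :: "'a set set"

definition uniform_hypergraph :: "nat \<Rightarrow> 'a hypergraph \<Rightarrow> bool" where
  "uniform_hypergraph q H \<longleftrightarrow>
     (\<forall>e \<in> edges H. e \<subseteq> vertices H \<and> finite e \<and> card e = q)"

definition independent_set :: "'a hypergraph \<Rightarrow> 'a set \<Rightarrow> bool" where
  "independent_set H S \<longleftrightarrow> S \<subseteq> vertices H \<and> \<not> (\<exists>e \<in> edges H. e \<subseteq> S)"

definition induced_subhypergraph :: "'a hypergraph \<Rightarrow> 'a set \<Rightarrow> 'a hypergraph" where
  "induced_subhypergraph H S = \<lparr>vertices = S, edges = {e \<in> edges H. e \<subseteq> S}\<rparr>"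

definition hypergraph_isomorphic :: "'a hypergraph \<Rightarrow> 'b hypergraph \<Rightarrow> bool" where
  "hypergraph_isomorphic G H \<longleftrightarrow>
     (\<exists>f. bij_betw f (vertices G) (vertices H) \<and>
          (\<forall>e. e \<subseteq> vertices G \<longrightarrow> (e \<in> edges G \<longleftrightarrow> f ` e \<in> edges H)))"

definition M_class :: "nat \<Rightarrow> nat \<Rightarrow> 'a hypergraph \<Rightarrow> bool" where
  "M_class q t G \<longleftrightarrow>
     uniform_hypergraph q G \<and>
     (\<exists>P :: nat \<Rightarrow> 'a set.
        disjoint_family P \<and> vertices G = (\<Union>i. P i) \<and>
        (\<forall>i. finite (P i) \<and> card (P i) = t) \<and>
        (\<forall>e. e \<subseteq> vertices G \<and> finite e \<and> card e = q \<and> (\<forall>i. card (e \<inter> P i) \<le> 1)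
              \<longrightarrow> e \<in> edges G) \<and>
        (\<forall>e \<in> edges G. \<forall>i. \<not> e \<subseteq> P i))"

text \<open>
  The members of the class are taken on the vertex type of the host hypergraph.
  This loses nothing: by the next lemma, an induced subhypergraph isomorphic to a member of the
  class on any other type is itself a member of the class.
\<close>

lemma M_class_isomorphic:
  fixes G :: "'a hypergraph" and K :: "'b hypergraph"
  assumes iso: "hypergraph_isomorphic G K" and K: "M_class q t K"
    and sub: "\<And>e. e \<in> edges G \<Longrightarrow> e \<subseteq> vertices G"
  shows "M_class q t G"
proof -
  obtain f where f: "bij_betw f (vertices G) (vertices K)"
    and fe: "\<And>e. e \<subseteq> vertices G \<Longrightarrow> e \<in> edges G \<longleftrightarrow> f ` e \<in> edges K"
    using iso unfolding hypergraph_isomorphic_def by blast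
  have inj: "inj_on f (vertices G)" and im: "f ` vertices G = vertices K"
    using f by (auto simp: bij_betw_def)
  have unif: "\<And>e. e \<in> edges K \<Longrightarrow> finite e \<and> card e = q"
    using K by (simp add: M_class_def uniform_hypergraph_def)
  obtain P :: "nat \<Rightarrow> 'b set" where P: "disjoint_family P" "vertices K = (\<Union>i. P i)"
    "\<And>i. finite (P i) \<and> card (P i) = t"
    "\<And>e. \<lbrakk>e \<subseteq> vertices K; finite e; card e = q; \<And>i. card (e \<inter> P i) \<le> 1\<rbrakk> \<Longrightarrow> e \<in> edges K"
    "\<And>e i. e \<in> edges K \<Longrightarrow> \<not> e \<subseteq> P i"
    using K unfolding M_class_def by metis
  define Q where "Q i = {v \<in> vertices G. f v \<in> P i}" for i
  have Q_sub: "Q i \<subseteq> vertices G" for i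
    by (auto simp: Q_def)
  have P_sub: "P i \<subseteq> f ` vertices G" for i
    using im P(2) by auto
  have fQ: "f ` Q i = P i" for i
    using P_sub[of i] by (auto simp: Q_def)
  have card_f: "finite (f ` e) \<longleftrightarrow> finite e" "card (f ` e) = card e" if "e \<subseteq> vertices G" for e
    using inj_on_subset[OF inj that] by (auto simp: finite_image_iff card_image)
  have 1: "disjoint_family Q"
    using P(1) by (fastforce simp: disjoint_family_on_def Q_def)
  have 2: "vertices G = (\<Union>i. Q i)"
  proof -
    have "\<exists>i. f v \<in> P i" if "v \<in> vertices G" for v
      using im P(2) that by auto
    then show ?thesis by (auto simp: Q_def)
  qed
  have 3: "finite (Q i) \<and> card (Q i) = t" for i
    using P(3)[of i] card_f[OF Q_sub[of i]] fQ[of i] by simp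
  have 4: "e \<in> edges G"
    if e: "e \<subseteq> vertices G" "finite e" "card e = q" "\<And>i. card (e \<inter> Q i) \<le> 1" for e
  proof -
    have "f ` e \<inter> P i = f ` (e \<inter> Q i)" for i
      using e(1) by (auto simp: Q_def)
    moreover have "card (f ` (e \<inter> Q i)) \<le> 1" for i
      using e(4)[of i] card_f(2)[of "e \<inter> Q i"] Q_sub[of i] by (simp add: le_infI2)
    ultimately have small: "card (f ` e \<inter> P i) \<le> 1" for i
      by simp
    have "f ` e \<in> edges K"
      by (rule P(4)) (use e im card_f[OF e(1)] small in auto)
    then show ?thesis using fe[OF e(1)] by simp
  qed
  have 5: "\<not> e \<subseteq> Q i" if "e \<in> edges G" for e i
    using P(5)[of "f ` e" i] fe[OF sub[OF that]] that fQ[of i] image_mono[of e "Q i" f] by auto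
  have "uniform_hypergraph q G"
    unfolding uniform_hypergraph_def
  proof
    fix e assume e: "e \<in> edges G"
    have "f ` e \<in> edges K" using fe[OF sub[OF e]] e by simp
    from unif[OF this] show "e \<subseteq> vertices G \<and> finite e \<and> card e = q"
      using card_f[OF sub[OF e]] sub[OF e] by simp
  qed
  then show ?thesis
    unfolding M_class_def
    by (intro conjI exI[of _ Q]) (use 1 2 3 4 5 in simp_all)
qed

definition M_free :: "nat \<Rightarrow> nat \<Rightarrow> 'a hypergraph \<Rightarrow> bool" where
  "M_free q t H \<longleftrightarrow>
     \<not> (\<exists>S (K :: 'a hypergraph).
          S \<subseteq> vertices H \<and> M_class q t K \<and>
          hypergraph_isomorphic (induced_subhypergraph H S) K)"

end

theory Submission imports Defs begin

text \<open>
  The sets of vertices that contain no large independent set form an ideal, which is proper by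
  hypothesis. Extend it to a prime ideal \<open>J\<close>; the sets outside \<open>J\<close> form an ultrafilter all of whose
  members contain arbitrarily large independent sets. Quantifying a \<open>q\<close>-tuple of vertices with
  respect to this ultrafilter, one coordinate after the other, the tuple is either almost surely an
  edge or almost surely a non-edge. One then chooses greedily disjoint independent sets
  \<open>T\<^sub>0, T\<^sub>1, \<dots>\<close> of size \<open>t\<close> whose transversal \<open>q\<close>-sets all follow this almost sure behaviour. In the
  first case they form a forbidden subhypergraph, and in the second case any transversal is an
  infinite independent set.
\<close>

section \<open>Prime ideals of sets\<close>

definition set_ideal :: "'a set set \<Rightarrow> bool" where
  "set_ideal J \<longleftrightarrow> {} \<in> J \<and> (\<forall>X\<in>J. \<forall>Y\<in>J. X \<union> Y \<in> J) \<and> (\<forall>X\<in>J. \<forall>Y\<subseteq>X. Y \<in> J)"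

lemma set_idealD:
  assumes "set_ideal J"
  shows "{} \<in> J" "X \<in> J \<Longrightarrow> Y \<in> J \<Longrightarrow> X \<union> Y \<in> J" "X \<in> J \<Longrightarrow> Y \<subseteq> X \<Longrightarrow> Y \<in> J"
  using assms unfolding set_ideal_def by blast+

lemma set_ideal_Union_finite:
  assumes "set_ideal J" "finite \<X>" "\<X> \<subseteq> J"
  shows "\<Union>\<X> \<in> J"
  using assms(2,3) by (induction \<X>) (simp_all add: set_idealD[OF assms(1)])

text \<open>This is the ideal generated by \<open>J\<close> and \<open>X\<close>; the Zorn argument
  below adjoins a single set in this way.\<close>

lemma set_ideal_generated:
  assumes "set_ideal J"
  shows "set_ideal {Y. \<exists>Z\<in>J. Y \<subseteq> Z \<union> X}"
  unfolding set_ideal_def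
proof (intro conjI ballI allI impI)
  show "{} \<in> {Y. \<exists>Z\<in>J. Y \<subseteq> Z \<union> X}"
    using assms by (auto simp: set_ideal_def)
next
  fix A B assume "A \<in> {Y. \<exists>Z\<in>J. Y \<subseteq> Z \<union> X}" "B \<in> {Y. \<exists>Z\<in>J. Y \<subseteq> Z \<union> X}"
  then obtain Z W where "Z \<in> J" "W \<in> J" "A \<subseteq> Z \<union> X" "B \<subseteq> W \<union> X"
    by auto
  moreover from this have "Z \<union> W \<in> J"
    using assms by (simp add: set_ideal_def)
  ultimately show "A \<union> B \<in> {Y. \<exists>Z\<in>J. Y \<subseteq> Z \<union> X}"
    by (auto intro!: bexI[of _ "Z \<union> W"])
qed blast

text \<open>Zorn's lemma yields a maximal proper ideal above \<open>I\<close>. It is prime because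
  adjoining a set to it either changes nothing or produces an ideal containing
  \<open>UNIV\<close>.\<close>

lemma prime_set_ideal_extension:
  assumes I: "set_ideal I" "UNIV \<notin> I"
  shows "\<exists>J. I \<subseteq> J \<and> set_ideal J \<and> UNIV \<notin> J \<and> (\<forall>X. X \<in> J \<or> - X \<in> J)"
proof -
  define \<A> where "\<A> = {J. I \<subseteq> J \<and> set_ideal J \<and> UNIV \<notin> J}"
  have "\<exists>M\<in>\<A>. \<forall>X\<in>\<A>. M \<subseteq> X \<longrightarrow> X = M"
  proof (rule subset_Zorn_nonempty)
    show "\<A> \<noteq> {}"
      using I by (auto simp: \<A>_def)
  next
    fix \<C> assume ne: "\<C> \<noteq> {}" and chain: "subset.chain \<A> \<C>"
    have sub: "\<C> \<subseteq> \<A>" and lin: "\<And>J K. J \<in> \<C> \<Longrightarrow> K \<in> \<C> \<Longrightarrow> J \<subseteq> K \<or> K \<subseteq> J"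
      using chain by (auto simp: subset.chain_def)
    have "set_ideal (\<Union>\<C>)"
      unfolding set_ideal_def
    proof (intro conjI ballI allI impI)
      show "{} \<in> \<Union>\<C>"
        using ne sub by (auto simp: \<A>_def set_ideal_def)
    next
      fix X Y assume "X \<in> \<Union>\<C>" "Y \<in> \<Union>\<C>"
      then obtain J where "J \<in> \<C>" "X \<in> J" "Y \<in> J"
        using lin by blast
      moreover from this have "X \<union> Y \<in> J"
        using sub by (intro set_idealD(2)) (auto simp: \<A>_def)
      ultimately show "X \<union> Y \<in> \<Union>\<C>"
        by blast
    next
      fix X Y assume "X \<in> \<Union>\<C>" "Y \<subseteq> X"
      then obtain J where "J \<in> \<C>" "X \<in> J"
        by blast
      moreover from this have "Y \<in> J"
        using sub \<open>Y \<subseteq> X\<close> by (intro set_idealD(3)[of J X Y]) (auto simp: \<A>_def)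
      ultimately show "Y \<in> \<Union>\<C>"
        by blast
    qed
    then show "\<Union>\<C> \<in> \<A>"
      using ne sub by (auto simp: \<A>_def)
  qed
  then obtain M where M: "I \<subseteq> M" "set_ideal M" "UNIV \<notin> M"
    and max: "\<And>J. J \<in> \<A> \<Longrightarrow> M \<subseteq> J \<Longrightarrow> J = M"
    by (auto simp: \<A>_def)
  \<comment> \<open>If adjoining \<open>X\<close> to \<open>M\<close> yields \<open>UNIV\<close>,
    some member of \<open>M\<close> covers \<open>- X\<close>; otherwise maximality puts
    \<open>X\<close> into \<open>M\<close>.\<close>
  have "X \<in> M \<or> - X \<in> M" for X
  proof (cases "\<exists>Z\<in>M. UNIV \<subseteq> Z \<union> X")
    case True
    then obtain Z where "Z \<in> M" "- X \<subseteq> Z"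
      by auto
    then show ?thesis
      using set_idealD(3)[OF M(2)] by blast
  next
    case False
    let ?K = "{Y. \<exists>Z\<in>M. Y \<subseteq> Z \<union> X}"
    have "M \<subseteq> ?K"
      by blast
    moreover have "?K \<in> \<A>"
      using False set_ideal_generated[OF M(2)] M(1) \<open>M \<subseteq> ?K\<close> by (auto simp: \<A>_def)
    ultimately have "?K = M"
      by (rule max[rotated])
    moreover have "{} \<in> M"
      using M(2) by (simp add: set_ideal_def)
    ultimately show ?thesis
      by blast
  qed
  with M show ?thesis
    by blast
qed

section \<open>Sets without large independent subsets\<close>

text \<open>These are the sets of bounded independence number. \<open>X\<close> ranges over all sets
  of the type, but independent sets lie in \<open>vertices H\<close>, so properness of the ideal can
  be expressed with \<open>UNIV\<close>.\<close>

definition small_sets :: "'a hypergraph \<Rightarrow> 'a set set" where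
  "small_sets H = {X. \<exists>n. \<forall>S\<subseteq>X. finite S \<and> independent_set H S \<longrightarrow> card S \<le> n}"

lemma small_sets_iff:
  "X \<in> small_sets H \<longleftrightarrow> (\<exists>n. \<forall>S\<subseteq>X. finite S \<and> independent_set H S \<longrightarrow> card S \<le> n)"
  by (simp add: small_sets_def)

lemma independent_set_subset:
  "independent_set H S \<Longrightarrow> T \<subseteq> S \<Longrightarrow> independent_set H T"
  unfolding independent_set_def by blast

lemma finite_imp_small: "finite X \<Longrightarrow> X \<in> small_sets H"
  by (auto simp: small_sets_def intro!: exI[of _ "card X"] card_mono)

lemma set_ideal_small_sets: "set_ideal (small_sets H)"
  unfolding set_ideal_def
proof (intro conjI ballI allI impI)
  show "{} \<in> small_sets H"
    by (rule finite_imp_small) simp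
next
  fix X Y assume "X \<in> small_sets H" "Y \<in> small_sets H"
  obtain m where m: "\<forall>S\<subseteq>X. finite S \<and> independent_set H S \<longrightarrow> card S \<le> m"
    using \<open>X \<in> small_sets H\<close> unfolding small_sets_iff ..
  obtain n where n: "\<forall>S\<subseteq>Y. finite S \<and> independent_set H S \<longrightarrow> card S \<le> n"
    using \<open>Y \<in> small_sets H\<close> unfolding small_sets_iff ..
  \<comment> \<open>An independent set in a union splits into two independent pieces, so the bounds
    add up.\<close>
  have "card S \<le> m + n" if S: "S \<subseteq> X \<union> Y" "finite S" "independent_set H S" for S
  proof -
    have "S = (S \<inter> X) \<union> (S \<inter> Y)"
      using S(1) by blast
    then have "card S \<le> card (S \<inter> X) + card (S \<inter> Y)"
      by (metis card_Un_le)
    also have "\<dots> \<le> m + n"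
      using S by (intro add_mono m[rule_format] n[rule_format]) (auto intro: independent_set_subset)
    finally show ?thesis .
  qed
  then show "X \<union> Y \<in> small_sets H"
    unfolding small_sets_iff by blast
next
  fix X Y assume "X \<in> small_sets H" "Y \<subseteq> X"
  then obtain n where "\<forall>S\<subseteq>X. finite S \<and> independent_set H S \<longrightarrow> card S \<le> n"
    unfolding small_sets_iff by blast
  then have "\<forall>S\<subseteq>Y. finite S \<and> independent_set H S \<longrightarrow> card S \<le> n"
    using \<open>Y \<subseteq> X\<close> by (meson order_trans)
  then show "Y \<in> small_sets H"
    unfolding small_sets_iff by blast
qed

lemma independent_subset_of_not_small:
  assumes "X \<notin> small_sets H"
  obtains S where "S \<subseteq> X" "finite S" "card S = t" "independent_set H S"
proof -
  obtain S where S: "S \<subseteq> X" "finite S" "independent_set H S" "t < card S"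
    using assms unfolding small_sets_iff by (auto simp: not_le)
  obtain T where "T \<subseteq> S" "finite T" "card T = t"
    using obtain_subset_with_card_n[of t S] S(4) by auto
  moreover from this have "independent_set H T"
    by (intro independent_set_subset[OF S(3)])
  ultimately show thesis
    using S(1) by (intro that[of T]) auto
qed

section \<open>Iterated almost sure behaviour\<close>

text \<open>\<open>almost_edge E J k e\<close>: adding \<open>k\<close> generic vertices to \<open>e\<close>, one after the other, yields a member
  of \<open>E\<close>.\<close>

primrec almost_edge :: "'a set set \<Rightarrow> 'a set set \<Rightarrow> nat \<Rightarrow> 'a set \<Rightarrow> bool" where
  "almost_edge E J 0 e \<longleftrightarrow> e \<in> E"
| "almost_edge E J (Suc k) e \<longleftrightarrow> {z. almost_edge E J k (insert z e)} \<notin> J"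

text \<open>A false value means that the set of good \<open>z\<close> lies in \<open>J\<close>; a
  true value means, by primality, that its complement does. Either set is exactly the set of
  exceptions.\<close>

lemma almost_edge_exceptions:
  assumes prime: "\<forall>X. X \<in> J \<or> - X \<in> J"
  shows "{z. almost_edge E J k (insert z e) \<noteq> almost_edge E J (Suc k) e} \<in> J"
proof (cases "almost_edge E J (Suc k) e")
  case True
  then have "- {z. almost_edge E J k (insert z e)} \<in> J"
    using prime[rule_format, of "{z. almost_edge E J k (insert z e)}"] by simp
  then show ?thesis
    using True by (simp add: Collect_neg_eq)
qed simp

text \<open>Finitely many pairs \<open>(e, k)\<close> matter, each with an exceptional set in
  \<open>J\<close>. These sets together with \<open>F\<close> have a union in \<open>J\<close>, so
  its complement is outside \<open>J\<close> and contains independent sets of every size.\<close>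

lemma next_part:
  assumes J: "small_sets H \<subseteq> J" "set_ideal J" "UNIV \<notin> J" "\<forall>X. X \<in> J \<or> - X \<in> J"
    and F: "finite F"
  shows "\<exists>T. finite T \<and> card T = t \<and> independent_set H T \<and> T \<inter> F = {} \<and>
    (\<forall>e\<subseteq>F. \<forall>k<q. \<forall>z\<in>T. almost_edge E J k (insert z e) = almost_edge E J (Suc k) e)"
proof -
  define bad where
    "bad = (\<lambda>(e, k). {z. almost_edge E J k (insert z e) \<noteq> almost_edge E J (Suc k) e})"
  let ?B = "insert F (bad ` (Pow F \<times> {..<q}))"
  have "bad p \<in> J" for p
    unfolding bad_def by (cases p) (simp only: prod.case almost_edge_exceptions[OF J(4)])
  then have "?B \<subseteq> J"
    using J(1) finite_imp_small[OF F] by blast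
  then have B: "\<Union>?B \<in> J"
    using F by (intro set_ideal_Union_finite[OF J(2)]) auto
  have "- \<Union>?B \<notin> J"
  proof
    assume "- \<Union>?B \<in> J"
    with B have "\<Union>?B \<union> - \<Union>?B \<in> J"
      using J(2) unfolding set_ideal_def by blast
    with J(3) show False
      by (metis Compl_partition)
  qed
  then have "- \<Union>?B \<notin> small_sets H"
    using J(1) by blast
  then obtain T where T: "T \<subseteq> - \<Union>?B" "finite T" "card T = t" "independent_set H T"
    by (rule independent_subset_of_not_small)
  have "almost_edge E J k (insert z e) = almost_edge E J (Suc k) e"
    if "e \<subseteq> F" "k < q" "z \<in> T" for e k z
  proof -
    have "z \<notin> bad (e, k)"
      using that T(1) by blast
    then show ?thesis
      unfolding bad_def by blast
  qed
  moreover have "T \<inter> F = {}"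
    using T(1) by blast
  ultimately show ?thesis
    using T by blast
qed

text \<open>Iterating \<open>next_part\<close> makes every vertex generic over the earlier parts.
  The common value \<open>val\<close> is then whether a generic \<open>q\<close>-tuple is an
  edge.\<close>

lemma homogeneous_parts:
  fixes H :: "'a hypergraph"
  assumes large: "UNIV \<notin> small_sets H"
  shows "\<exists>(T :: nat \<Rightarrow> 'a set) val. disjoint_family T \<and>
    (\<forall>i. finite (T i) \<and> card (T i) = t \<and> independent_set H (T i)) \<and>
    (\<forall>e. e \<subseteq> (\<Union>i. T i) \<and> finite e \<and> card e = q \<and> (\<forall>i. card (e \<inter> T i) \<le> 1) \<longrightarrow>
      (e \<in> edges H \<longleftrightarrow> val))"
proof -
  obtain J where J: "small_sets H \<subseteq> J" "set_ideal J" "UNIV \<notin> J" "\<forall>X. X \<in> J \<or> - X \<in> J"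
    using prime_set_ideal_extension[OF set_ideal_small_sets large] by blast
  let ?G = "almost_edge (edges H) J"
  define c where "c F = (SOME T. finite T \<and> card T = t \<and> independent_set H T \<and>
      T \<inter> F = {} \<and> (\<forall>e\<subseteq>F. \<forall>k<q. \<forall>z\<in>T. ?G k (insert z e) = ?G (Suc k) e))" for F
  have c: "finite (c F) \<and> card (c F) = t \<and> independent_set H (c F) \<and>
      c F \<inter> F = {} \<and> (\<forall>e\<subseteq>F. \<forall>k<q. \<forall>z\<in>c F. ?G k (insert z e) = ?G (Suc k) e)"
    if "finite F" for F
    unfolding c_def by (rule someI_ex) (rule next_part[OF J that])
  \<comment> \<open>\<open>F n\<close> is the union of the parts \<open>T i\<close> with
    \<open>i < n\<close>.\<close>
  define F where "F n = ((\<lambda>F. F \<union> c F) ^^ n) {}" for n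
  define T where "T n = c (F n)" for n
  have F_0: "F 0 = {}" and F_Suc: "F (Suc n) = F n \<union> T n" for n
    by (simp_all add: F_def T_def)
  have fin: "finite (F n)" for n
    by (induction n) (simp_all add: F_0 F_Suc T_def c)
  have T: "finite (T n)" "card (T n) = t" "independent_set H (T n)" "T n \<inter> F n = {}"
    and step: "\<forall>e\<subseteq>F n. \<forall>k<q. \<forall>z\<in>T n. ?G k (insert z e) = ?G (Suc k) e" for n
    using c[OF fin, of n] unfolding T_def by simp_all
  have F_mono: "F m \<subseteq> F n" if "m \<le> n" for m n
    using that by (rule lift_Suc_mono_le[rotated]) (simp add: F_Suc)
  have T_F: "T m \<subseteq> F n" if "m < n" for m n
    using F_mono[of "Suc m" n] that by (auto simp: F_Suc)
  have disj: "disjoint_family T"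
    unfolding disjoint_family_on_def
  proof (intro ballI impI)
    fix m n :: nat assume "m \<noteq> n"
    then show "T m \<inter> T n = {}"
      using T_F[of m n] T_F[of n m] T(4)[of m] T(4)[of n] by (cases "m < n") force+
  qed
  \<comment> \<open>Adding vertices in the order of their parts never changes the truth value. The
    induction removes the vertex of \<open>e\<close> in the newest part; \<open>card e = q\<close>
    will give membership in \<open>edges H\<close>.\<close>
  have hom: "?G (q - card e) e = ?G q {}"
    if "e \<subseteq> F n" "card e \<le> q" "\<And>i. card (e \<inter> T i) \<le> 1" for e n
    using that
  proof (induction n arbitrary: e)
    case 0
    then show ?case
      by (simp add: F_0)
  next
    case (Suc n)
    have fin_e: "finite e"
      using Suc.prems(1) fin finite_subset by blast
    show ?case
    proof (cases "e \<inter> T n = {}")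
      case True
      then have "e \<subseteq> F n"
        using Suc.prems(1) by (auto simp: F_Suc)
      then show ?thesis
        using Suc by blast
    next
      case False
      then obtain z where z: "e \<inter> T n = {z}"
        using Suc.prems(3)[of n] fin_e
        by (metis One_nat_def card_0_eq card_1_singletonE finite_Int le_SucE le_zero_eq)
      define d where "d = e - {z}"
      have "z \<in> e"
        using z by blast
      then have e: "insert z d = e"
        by (auto simp: d_def)
      have card_e: "card e = Suc (card d)"
        using card_Suc_Diff1[OF fin_e \<open>z \<in> e\<close>] by (simp add: d_def)
      have "d \<subseteq> F n"
        using Suc.prems(1) z by (auto simp: F_Suc d_def)
      moreover have "card (d \<inter> T i) \<le> 1" for i
        by (rule order_trans[OF card_mono Suc.prems(3)[of i]]) (use fin_e in \<open>auto simp: d_def\<close>)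
      ultimately have "?G (q - card d) d = ?G q {}"
        using card_e Suc.prems(2) by (intro Suc.IH) simp_all
      \<comment> \<open>This matches the index in \<open>step\<close> at \<open>d\<close>; as
        \<open>e\<close> is nonempty, \<open>q - card e < q\<close> is in its range.\<close>
      moreover have "q - card d = Suc (q - card e)"
        using card_e Suc.prems(2) by simp
      moreover have "?G (q - card e) (insert z d) = ?G (Suc (q - card e)) d"
        using \<open>d \<subseteq> F n\<close> z card_e Suc.prems(2) by (intro step[rule_format, of d n]) auto
      ultimately show ?thesis
        by (simp only: e)
    qed
  qed
  show ?thesis
  proof (intro exI[of _ T] exI[of _ "?G q {}"] conjI allI impI)
    fix e assume "e \<subseteq> (\<Union>i. T i) \<and> finite e \<and> card e = q \<and> (\<forall>i. card (e \<inter> T i) \<le> 1)"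
    then have e: "e \<subseteq> (\<Union>i. T i)" "finite e" "card e = q" "\<And>i. card (e \<inter> T i) \<le> 1"
      by blast+
    have "\<exists>n. e \<subseteq> F n"
      using e(2,1)
    proof (induction e)
      case (insert x e)
      then obtain m n where "e \<subseteq> F m" "x \<in> T n"
        by auto
      \<comment> \<open>The successor is essential: \<open>T n\<close> first enters at stage
        \<open>Suc n\<close>.\<close>
      then have "insert x e \<subseteq> F (max m (Suc n))"
        using F_mono[of m "max m (Suc n)"] T_F[of n "max m (Suc n)"] by (auto simp: less_max_iff_disj)
      then show ?case ..
    qed simp
    then obtain n where "e \<subseteq> F n" ..
    then show "e \<in> edges H \<longleftrightarrow> ?G q {}"
      using hom[of e n] e by simp
  qed (use disj T in simp_all)
qed

theorem theorem18:
  fixes q t :: nat and H :: "'a hypergraph"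
  assumes "q > 0" and "t > 0"
    and "uniform_hypergraph q H"
    and "M_free q t H"
    and "\<And>n :: nat. \<exists>S. finite S \<and> card S \<ge> n \<and> independent_set H S"
  shows "\<exists>S. infinite S \<and> independent_set H S"
proof -
  have "UNIV \<notin> small_sets H"
  proof
    assume "UNIV \<in> small_sets H"
    then obtain n where n: "\<forall>S. finite S \<and> independent_set H S \<longrightarrow> card S \<le> n"
      unfolding small_sets_iff by auto
    obtain S where "finite S" "card S \<ge> Suc n" "independent_set H S"
      using assms(5) by blast
    with n show False
      by fastforce
  qed
  then obtain T :: "nat \<Rightarrow> 'a set" and val where disj: "disjoint_family T"
    and T: "\<forall>i. finite (T i) \<and> card (T i) = t \<and> independent_set H (T i)"
    and hom: "\<forall>e. e \<subseteq> (\<Union>i. T i) \<and> finite e \<and> card e = q \<and> (\<forall>i. card (e \<inter> T i) \<le> 1) \<longrightarrow>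
      (e \<in> edges H \<longleftrightarrow> val)"
    using homogeneous_parts[where t = t and q = q] by blast
  have T_vertices: "T i \<subseteq> vertices H" for i
    using T[rule_format, of i] by (simp add: independent_set_def)
  have edge: "finite e" "card e = q" if "e \<in> edges H" for e
    using assms(3) that by (auto simp: uniform_hypergraph_def)
  \<comment> \<open>Otherwise all transversal \<open>q\<close>-sets are edges, while independence of
    each \<open>T i\<close> excludes edges inside a part: the union of the parts induces a member of
    the forbidden class.\<close>
  have "\<not> val"
  proof
    assume val
    let ?K = "induced_subhypergraph H (\<Union>i. T i)"
    have "M_class q t ?K"
      unfolding M_class_def
    proof (intro conjI exI[of _ T] allI impI ballI)
      show "uniform_hypergraph q ?K"
        using edge by (simp add: uniform_hypergraph_def induced_subhypergraph_def)
    next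
      fix e i assume "e \<in> edges ?K"
      then show "\<not> e \<subseteq> T i"
        using T[rule_format, of i] by (auto simp: induced_subhypergraph_def independent_set_def)
    next
      fix e assume e: "e \<subseteq> vertices ?K \<and> finite e \<and> card e = q \<and> (\<forall>i. card (e \<inter> T i) \<le> 1)"
      then have "e \<in> edges H"
        using hom \<open>val\<close> by (simp add: induced_subhypergraph_def)
      with e show "e \<in> edges ?K"
        by (simp add: induced_subhypergraph_def)
    next
      show "vertices ?K = (\<Union>i. T i)"
        by (simp add: induced_subhypergraph_def)
    qed (use disj T in simp_all)
    moreover have "hypergraph_isomorphic ?K ?K"
      unfolding hypergraph_isomorphic_def by (intro exI[of _ id]) simp
    ultimately show False
      using assms(4) T_vertices unfolding M_free_def by blast
  qed
  \<comment> \<open>Positivity of \<open>t\<close> makes the parts nonempty, so a transversal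
    \<open>v\<close> exists.\<close>
  have "\<exists>x. x \<in> T i" for i
    using T[rule_format, of i] assms(2) by (metis card.empty ex_in_conv less_irrefl)
  then obtain v where v: "\<And>i. v i \<in> T i"
    by metis
  have v_T: "v j \<in> T i \<longleftrightarrow> j = i" for i j
    using disj v[of j] v[of i] by (auto simp: disjoint_family_on_def)
  have "inj v"
    by (metis injI v_T)
  then have "infinite (range v)"
    using finite_imageD[of v UNIV] infinite_UNIV_nat by blast
  moreover have "independent_set H (range v)"
    unfolding independent_set_def
  proof (intro conjI notI)
    show "range v \<subseteq> vertices H"
      using v T_vertices by blast
  next
    assume "\<exists>e\<in>edges H. e \<subseteq> range v"
    then obtain e where e: "e \<in> edges H" "e \<subseteq> range v"
      by blast
    \<comment> \<open>An edge inside the transversal would be a transversal \<open>q\<close>-set,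
      hence an edge only if \<open>val\<close> holds.\<close>
    have "card (e \<inter> T i) \<le> 1" for i
    proof -
      have "e \<inter> T i \<subseteq> {v i}"
        using e(2) v_T by auto
      then show ?thesis
        using card_mono[of "{v i}" "e \<inter> T i"] by simp
    qed
    moreover have "e \<subseteq> (\<Union>i. T i)"
      using e(2) v by blast
    ultimately have "e \<in> edges H \<longleftrightarrow> val"
      using edge[OF e(1)] by (intro hom[rule_format]) simp
    with e(1) \<open>\<not> val\<close> show False
      by simp
  qed
  ultimately show ?thesis
    by blast
qed

end
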